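(* Let $\mathbb{F}$ be a finite field with $n=|\mathbb{F}|$ elements and $R=M_2(\mathbb{F})$. Then the idempotent graph $I(R)$ is a disjoint union of $\frac{n(n+1)}{2}$ copies of $K_2$.
   Context: For a ring $R$, the idempotent graph $I(R)$ is the simple graph whose vertices are the nontrivial idempotents of $R$ (idempotents other than $0$ and $1$), with distinct vertices $h,k$ adjacent iff $hk=kh=0$. $K_2$ is the complete graph on two vertices. *)

theory Defs
  imports
    "HOL-Library.Cardinality"
    "HOL-Algebra.Ring"
    "Jordan_Normal_Form.Matrix"
    "Graph_Theory.Graph_Theory"
begin

text \<open>
  As in the library, a simple undirected graph is a symmetric loop-free digraph without
  parallel arcs: an edge between \<open>u\<close> and \<open>v\<close> is the pair of arcs \<open>(u, v)\<close>, \<open>(v, u)\<close>.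
\<close>

definition nontrivial_idempotents :: "('a, 'm) ring_scheme \<Rightarrow> 'a set" where
  "nontrivial_idempotents R =
     {e \<in> carrier R. e \<otimes>\<^bsub>R\<^esub> e = e \<and> e \<noteq> \<zero>\<^bsub>R\<^esub> \<and> e \<noteq> \<one>\<^bsub>R\<^esub>}"

definition idempotent_graph :: "('a, 'm) ring_scheme \<Rightarrow> 'a pair_pre_digraph" where
  "idempotent_graph R =
     \<lparr>pverts = nontrivial_idempotents R,
      parcs = {(h, k). h \<in> nontrivial_idempotents R \<and> k \<in> nontrivial_idempotents R \<and> h \<noteq> k \<and>
                       h \<otimes>\<^bsub>R\<^esub> k = \<zero>\<^bsub>R\<^esub> \<and> k \<otimes>\<^bsub>R\<^esub> h = \<zero>\<^bsub>R\<^esub>}\<rparr>"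

definition complete_graph :: "nat \<Rightarrow> nat pair_pre_digraph" where
  "complete_graph n =
     \<lparr>pverts = {..<n}, parcs = {(u, v). u \<in> {..<n} \<and> v \<in> {..<n} \<and> u \<noteq> v}\<rparr>"

lemma complete_digraph_complete_graph: "complete_digraph n (with_proj (complete_graph n))"
  unfolding complete_digraph_pair_def by (simp add: complete_graph_def)

definition disjoint_copies :: "nat \<Rightarrow> 'a pair_pre_digraph \<Rightarrow> (nat \<times> 'a) pair_pre_digraph" where
  "disjoint_copies m G =
     \<lparr>pverts = {..<m} \<times> pverts G,
      parcs = {((i, u), (j, v)). i < m \<and> i = j \<and> (u, v) \<in> parcs G}\<rparr>"

end

theory Submission
  imports Defs
begin

text \<open>
  In any ring \<open>e \<mapsto> 1 - e\<close> is a fixed-point-free involution on the nontrivial idempotents, and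
  \<open>e\<close> is adjacent to \<open>1 - e\<close>. The sum of two orthogonal nontrivial idempotents is again a
  nonzero idempotent. In \<open>M\<^sub>2(F)\<close> the nontrivial idempotents are the matrices of trace \<open>1\<close> and
  determinant \<open>0\<close>, so that such a sum has trace \<open>1 + 1 \<noteq> 1\<close> in every characteristic and can only
  be the identity: \<open>1 - e\<close> is the only neighbour of \<open>e\<close>. The number of idempotents is the number
  of solutions \<open>(a, b, c)\<close> of \<open>b c = a (1 - a)\<close>, which is \<open>n (n - 1)\<close> with \<open>b \<noteq> 0\<close> plus \<open>2 n\<close>
  with \<open>b = 0\<close>.
\<close>

section \<open>Disjoint unions of complete graphs\<close>

lemma digraph_iso_with_projI:
  assumes G: "pair_wf_digraph G" and H: "pair_wf_digraph H"
    and bij: "bij_betw f (pverts G) (pverts H)"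
    and arcs: "\<And>u v. u \<in> pverts G \<Longrightarrow> v \<in> pverts G \<Longrightarrow>
      (f u, f v) \<in> parcs H \<longleftrightarrow> (u, v) \<in> parcs G"
  shows "digraph_iso (with_proj G) (with_proj H)"
proof -
  interpret G: pair_wf_digraph G by (fact G)
  interpret H: pair_wf_digraph H by (fact H)
  let ?hom = "\<lparr>iso_verts = f, iso_arcs = map_prod f f, iso_head = snd, iso_tail = fst\<rparr>"
  have inj: "inj_on f (pverts G)" and verts: "f ` pverts G = pverts H"
    using bij by (auto simp: bij_betw_def)
  have "parcs G \<subseteq> pverts G \<times> pverts G"
    by (auto dest: G.wellformed')
  then have inj_arcs: "inj_on (map_prod f f) (parcs G)"
    using map_prod_inj_on[OF inj inj] by (rule inj_on_subset[rotated])
  have "map_prod f f ` parcs G = parcs H"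
  proof (intro equalityI subsetI)
    fix e assume "e \<in> map_prod f f ` parcs G"
    then show "e \<in> parcs H"
      using arcs by (auto dest: G.wellformed')
  next
    fix e assume e: "e \<in> parcs H"
    then have "e \<in> f ` pverts G \<times> f ` pverts G"
      unfolding verts by (cases e) (auto dest: H.wellformed')
    then obtain u v where "u \<in> pverts G" "v \<in> pverts G" "e = (f u, f v)"
      by blast
    with e arcs show "e \<in> map_prod f f ` parcs G"
      by (auto intro!: image_eqI[where x = "(u, v)"])
  qed
  then have "with_proj H = app_iso ?hom (with_proj G)"
    using verts by (simp add: with_proj_def app_iso_def)
  moreover have "G.digraph_isomorphism ?hom"
    unfolding G.digraph_isomorphism_def using G.wf_digraph_axioms inj inj_arcs by simp
  ultimately show ?thesis
    unfolding digraph_iso_def by blast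
qed

lemma card_eq_card_image_mult:
  assumes "finite V" and fibres: "\<And>x. x \<in> V \<Longrightarrow> card {y \<in> V. p y = p x} = r"
  shows "card V = card (p ` V) * r"
proof -
  have "card V = (\<Sum>c\<in>p ` V. card {y \<in> V. p y = c})"
    using sum.image_gen[OF \<open>finite V\<close>, of "\<lambda>_. 1 :: nat" p] by simp
  also have "\<dots> = (\<Sum>c\<in>p ` V. r)"
    using fibres by (intro sum.cong) auto
  finally show ?thesis
    by simp
qed

lemma uniform_fibres_labelling:
  assumes "finite V" and fibres: "\<And>x. x \<in> V \<Longrightarrow> card {y \<in> V. p y = p x} = r"
  obtains f where "bij_betw f V ({..<card (p ` V)} \<times> {..<r})"
    and "\<And>x y. x \<in> V \<Longrightarrow> y \<in> V \<Longrightarrow> fst (f x) = fst (f y) \<longleftrightarrow> p x = p y"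
proof -
  obtain q where "bij_betw q (p ` V) {..<card (p ` V)}"
    using ex_bij_betw_finite_nat[of "p ` V"] \<open>finite V\<close> by (auto simp: atLeast0LessThan)
  then have q: "inj_on q (p ` V)" "q ` p ` V = {..<card (p ` V)}"
    by (auto simp: bij_betw_def)
  have "\<exists>w. bij_betw w {y \<in> V. p y = c} {..<r}" if "c \<in> p ` V" for c
    using that fibres ex_bij_betw_finite_nat[of "{y \<in> V. p y = c}"] \<open>finite V\<close>
    by (auto simp: atLeast0LessThan)
  then obtain w where w: "bij_betw (w c) {y \<in> V. p y = c} {..<r}" if "c \<in> p ` V" for c
    by metis
  define f where "f x = (q (p x), w (p x) x)" for x
  have fst_f: "fst (f x) = fst (f y) \<longleftrightarrow> p x = p y" if "x \<in> V" "y \<in> V" for x y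
    using that inj_on_eq_iff[OF q(1)] by (simp add: f_def)
  have "inj_on f V"
  proof (rule inj_onI)
    fix x y assume xy: "x \<in> V" "y \<in> V" and eq: "f x = f y"
    then have p: "p x = p y"
      using fst_f[OF xy] by simp
    with eq have "w (p x) x = w (p x) y"
      by (simp add: f_def)
    with xy p w[of "p x"] show "x = y"
      by (auto simp: bij_betw_def dest: inj_onD)
  qed
  moreover have "f ` V \<subseteq> {..<card (p ` V)} \<times> {..<r}"
    using q(2) w by (fastforce simp: f_def bij_betw_def)
  moreover have "card V = card ({..<card (p ` V)} \<times> {..<r})"
    using card_eq_card_image_mult[of V p r] assms by simp
  ultimately have "bij_betw f V ({..<card (p ` V)} \<times> {..<r})"
    by (simp add: bij_betw_def card_image card_subset_eq)
  with fst_f show thesis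
    by (rule that[rotated])
qed

lemma pair_wf_digraph_disjoint_copies:
  "pair_wf_digraph G \<Longrightarrow> pair_wf_digraph (disjoint_copies m G)"
  by (auto simp: disjoint_copies_def pair_wf_digraph_def)

lemma pair_wf_digraph_complete_graph: "pair_wf_digraph (complete_graph n)"
  by (auto simp: complete_graph_def pair_wf_digraph_def)

lemma digraph_iso_disjoint_copies_complete_graph:
  assumes fin: "finite (pverts G)"
    and fibres: "\<And>x. x \<in> pverts G \<Longrightarrow> card {y \<in> pverts G. p y = p x} = r"
    and arcs: "parcs G = {(x, y). x \<in> pverts G \<and> y \<in> pverts G \<and> x \<noteq> y \<and> p x = p y}"
  shows "digraph_iso (with_proj G)
    (with_proj (disjoint_copies (card (p ` pverts G)) (complete_graph r)))"
proof -
  let ?V = "pverts G" and ?H = "disjoint_copies (card (p ` pverts G)) (complete_graph r)"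
  obtain f where f: "bij_betw f ?V ({..<card (p ` ?V)} \<times> {..<r})"
    and fst_f: "\<And>x y. x \<in> ?V \<Longrightarrow> y \<in> ?V \<Longrightarrow> fst (f x) = fst (f y) \<longleftrightarrow> p x = p y"
    using uniform_fibres_labelling[OF fin fibres] by blast
  show ?thesis
  proof (rule digraph_iso_with_projI)
    show "pair_wf_digraph G"
      using arcs by (auto simp: pair_wf_digraph_def)
    show "pair_wf_digraph ?H"
      by (intro pair_wf_digraph_disjoint_copies pair_wf_digraph_complete_graph)
    show "bij_betw f ?V (pverts ?H)"
      using f by (simp add: disjoint_copies_def complete_graph_def)
  next
    fix x y assume xy: "x \<in> ?V" "y \<in> ?V"
    then have "f x \<in> {..<card (p ` ?V)} \<times> {..<r}" "f y \<in> {..<card (p ` ?V)} \<times> {..<r}"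
      using f by (auto simp: bij_betw_def)
    then have "(f x, f y) \<in> parcs ?H \<longleftrightarrow> fst (f x) = fst (f y) \<and> f x \<noteq> f y"
      by (auto simp: disjoint_copies_def complete_graph_def)
    also have "\<dots> \<longleftrightarrow> p x = p y \<and> x \<noteq> y"
      using fst_f[OF xy] inj_on_eq_iff[OF bij_betw_imp_inj_on[OF f] xy] by simp
    also have "\<dots> \<longleftrightarrow> (x, y) \<in> parcs G"
      using xy arcs by auto
    finally show "(f x, f y) \<in> parcs ?H \<longleftrightarrow> (x, y) \<in> parcs G" .
  qed
qed

lemma digraph_iso_disjoint_copies_K2:
  assumes fin: "finite (pverts G)"
    and closed: "\<And>x. x \<in> pverts G \<Longrightarrow> s x \<in> pverts G"
    and involution: "\<And>x. x \<in> pverts G \<Longrightarrow> s (s x) = x"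
    and fixed_point_free: "\<And>x. x \<in> pverts G \<Longrightarrow> s x \<noteq> x"
    and arcs: "parcs G = {(x, y). x \<in> pverts G \<and> y = s x}"
  shows "digraph_iso (with_proj G)
    (with_proj (disjoint_copies (card (pverts G) div 2) (complete_graph 2)))"
proof -
  let ?V = "pverts G" and ?orbit = "\<lambda>x. {x, s x}"
  have orbit_eq_iff: "?orbit x = ?orbit y \<longleftrightarrow> y = x \<or> y = s x" if "x \<in> ?V" "y \<in> ?V" for x y
    using that involution by (auto simp: doubleton_eq_iff)
  have fibres: "card {y \<in> ?V. ?orbit y = ?orbit x} = 2" if "x \<in> ?V" for x
  proof -
    have "{y \<in> ?V. ?orbit y = ?orbit x} = {x, s x}"
      using that closed orbit_eq_iff by blast
    then show ?thesis
      using fixed_point_free[OF that] by simp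
  qed
  have "parcs G = {(x, y). x \<in> ?V \<and> y \<in> ?V \<and> x \<noteq> y \<and> ?orbit x = ?orbit y}"
    unfolding arcs using closed fixed_point_free orbit_eq_iff by fastforce
  with fin fibres have "digraph_iso (with_proj G)
      (with_proj (disjoint_copies (card (?orbit ` ?V)) (complete_graph 2)))"
    by (rule digraph_iso_disjoint_copies_complete_graph)
  moreover from fin fibres have "card ?V = card (?orbit ` ?V) * 2"
    by (rule card_eq_card_image_mult)
  ultimately show ?thesis
    by simp
qed

section \<open>Orthogonal idempotents\<close>

context ring
begin

lemma nontrivial_idempotentsD:
  assumes "e \<in> nontrivial_idempotents R"
  shows "e \<in> carrier R" "e \<otimes> e = e" "e \<noteq> \<zero>" "e \<noteq> \<one>"
  using assms by (auto simp: nontrivial_idempotents_def)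

lemma one_minus_one_minus: "e \<in> carrier R \<Longrightarrow> \<one> \<ominus> (\<one> \<ominus> e) = e"
  by (simp add: minus_eq minus_add r_neg2)

lemma idempotent_orthogonal_one_minus:
  assumes "e \<in> carrier R" "e \<otimes> e = e"
  shows "e \<otimes> (\<one> \<ominus> e) = \<zero>" "(\<one> \<ominus> e) \<otimes> e = \<zero>"
  using assms by (simp_all add: minus_eq r_distr l_distr r_minus l_minus r_neg)

lemma one_minus_nontrivial_idempotent:
  assumes "e \<in> nontrivial_idempotents R"
  shows "\<one> \<ominus> e \<in> nontrivial_idempotents R"
proof -
  note e = nontrivial_idempotentsD[OF assms]
  let ?f = "\<one> \<ominus> e"
  have "?f \<otimes> ?f = ?f \<ominus> e \<otimes> ?f"
    using e(1) by (simp add: minus_eq l_distr l_minus)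
  also have "\<dots> = ?f"
    using e(1) idempotent_orthogonal_one_minus(1)[OF e(1,2)] by (simp add: minus_eq)
  finally have "?f \<otimes> ?f = ?f" .
  moreover have "?f \<noteq> \<zero>" "?f \<noteq> \<one>"
    using e one_minus_one_minus[OF e(1)] by (auto simp: minus_eq)
  ultimately show ?thesis
    using e(1) by (simp add: nontrivial_idempotents_def)
qed

lemma one_minus_neq_self:
  assumes "e \<in> nontrivial_idempotents R"
  shows "\<one> \<ominus> e \<noteq> e"
  using idempotent_orthogonal_one_minus(1)[of e] nontrivial_idempotentsD[OF assms] by auto

lemma idempotent_adjacent_one_minus:
  assumes "e \<in> nontrivial_idempotents R"
  shows "(e, \<one> \<ominus> e) \<in> parcs (idempotent_graph R)"
  using assms one_minus_nontrivial_idempotent one_minus_neq_self[symmetric]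
  by (simp add: idempotent_graph_def idempotent_orthogonal_one_minus nontrivial_idempotentsD)

lemma adjacent_idempotents_add:
  assumes "(h, k) \<in> parcs (idempotent_graph R)"
  shows "h \<oplus> k \<in> insert \<one> (nontrivial_idempotents R)"
proof -
  have orth: "h \<otimes> k = \<zero>" "k \<otimes> h = \<zero>"
    and "h \<in> nontrivial_idempotents R" "k \<in> nontrivial_idempotents R"
    using assms by (simp_all add: idempotent_graph_def)
  then have h: "h \<in> carrier R" "h \<otimes> h = h" "h \<noteq> \<zero>" and k: "k \<in> carrier R" "k \<otimes> k = k"
    by (simp_all add: nontrivial_idempotentsD)
  have "(h \<oplus> k) \<otimes> (h \<oplus> k) = h \<oplus> k"
    using h k orth by (simp add: l_distr r_distr)
  moreover have "h \<otimes> (h \<oplus> k) = h"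
    using h k orth by (simp add: r_distr)
  then have "h \<oplus> k \<noteq> \<zero>"
    using h by auto
  ultimately show ?thesis
    using h k by (auto simp: nontrivial_idempotents_def)
qed

lemma parcs_idempotent_graph_one_minus:
  assumes "\<And>h k. (h, k) \<in> parcs (idempotent_graph R) \<Longrightarrow> h \<oplus> k \<notin> nontrivial_idempotents R"
  shows "parcs (idempotent_graph R) = {(h, k). h \<in> nontrivial_idempotents R \<and> k = \<one> \<ominus> h}"
proof (intro equalityI subrelI)
  fix h k assume hk: "(h, k) \<in> parcs (idempotent_graph R)"
  then have h: "h \<in> nontrivial_idempotents R" and k: "k \<in> nontrivial_idempotents R"
    by (auto simp: idempotent_graph_def)
  have "h \<oplus> k = \<one>"
    using adjacent_idempotents_add[OF hk] assms[OF hk] by simp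
  then have "k = \<one> \<ominus> h"
    using h k by (metis add.inv_solve_right' a_comm minus_eq nontrivial_idempotentsD(1) one_closed)
  with h show "(h, k) \<in> {(h, k). h \<in> nontrivial_idempotents R \<and> k = \<one> \<ominus> h}"
    by simp
qed (auto intro: idempotent_adjacent_one_minus)

lemma idempotent_graph_iso_disjoint_copies_K2:
  assumes "finite (nontrivial_idempotents R)"
    and "\<And>h k. (h, k) \<in> parcs (idempotent_graph R) \<Longrightarrow> h \<oplus> k \<notin> nontrivial_idempotents R"
  shows "digraph_iso (with_proj (idempotent_graph R))
    (with_proj (disjoint_copies (card (nontrivial_idempotents R) div 2) (complete_graph 2)))"
proof -
  have verts: "pverts (idempotent_graph R) = nontrivial_idempotents R"
    by (simp add: idempotent_graph_def)
  have "parcs (idempotent_graph R) = {(h, k). h \<in> nontrivial_idempotents R \<and> k = \<one> \<ominus> h}"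
    by (rule parcs_idempotent_graph_one_minus) (fact assms(2))
  then show ?thesis
    using digraph_iso_disjoint_copies_K2[of "idempotent_graph R" "\<lambda>e. \<one> \<ominus> e"] assms(1)
    by (simp add: verts one_minus_nontrivial_idempotent one_minus_one_minus one_minus_neq_self
        nontrivial_idempotentsD)
qed

end

section \<open>Idempotent matrices of order two\<close>

definition mat2 :: "'a \<Rightarrow> 'a \<Rightarrow> 'a \<Rightarrow> 'a \<Rightarrow> 'a mat" where
  "mat2 a b c d =
    mat 2 2 (\<lambda>(i, j). if i = 0 then if j = 0 then a else b else if j = 0 then c else d)"

lemma mat2_carrier [simp]: "mat2 a b c d \<in> carrier_mat 2 2"
  by (simp add: mat2_def)

lemma mat2_index [simp]:
  "mat2 a b c d $$ (0, 0) = a" "mat2 a b c d $$ (0, Suc 0) = b"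
  "mat2 a b c d $$ (Suc 0, 0) = c" "mat2 a b c d $$ (Suc 0, Suc 0) = d"
  by (simp_all add: mat2_def)

lemma mat2_eq_iff [simp]:
  "mat2 a b c d = mat2 a' b' c' d' \<longleftrightarrow> a = a' \<and> b = b' \<and> c = c' \<and> d = d'"
  by (metis mat2_index)

lemma carrier_mat_2E:
  assumes "A \<in> carrier_mat 2 2"
  obtains a b c d where "A = mat2 a b c d"
proof
  show "A = mat2 (A $$ (0, 0)) (A $$ (0, 1)) (A $$ (1, 0)) (A $$ (1, 1))"
    using assms by (intro eq_matI) (auto simp: mat2_def less_2_cases_iff)
qed

lemma mat2_add: "mat2 a b c d + mat2 a' b' c' d' = mat2 (a + a') (b + b') (c + c') (d + d')"
  by (rule eq_matI) (auto simp: mat2_def)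

lemma mat2_mult:
  fixes a :: "'a :: semiring_0"
  shows "mat2 a b c d * mat2 a' b' c' d' =
    mat2 (a * a' + b * c') (a * b' + b * d') (c * a' + d * c') (c * b' + d * d')"
  by (rule eq_matI) (auto simp: mat2_def scalar_prod_def less_2_cases_iff numeral_2_eq_2)

lemma zero_mat_2: "0\<^sub>m 2 2 = mat2 0 0 0 0"
  by (rule eq_matI) (auto simp: mat2_def)

lemma one_mat_2: "1\<^sub>m 2 = mat2 1 0 0 1"
  by (rule eq_matI) (auto simp: mat2_def less_2_cases_iff)

lemma mat2_idempotent_iff:
  fixes a :: "'a :: idom"
  shows "mat2 a b c d * mat2 a b c d = mat2 a b c d \<longleftrightarrow>
    a + d = 1 \<and> a * d = b * c \<or> mat2 a b c d \<in> {0\<^sub>m 2 2, 1\<^sub>m 2}"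
    (is "?idem \<longleftrightarrow> ?char")
proof
  assume ?idem
  then have eqs: "a * a + b * c = a" "a * b + b * d = b" "c * a + d * c = c" "c * b + d * d = d"
    by (simp_all add: mat2_mult)
  \<comment> \<open>By Cayley--Hamilton \<open>A\<^sup>2 = A\<close> gives \<open>(tr A - 1) A = det A\<close>: \<open>A\<close> is scalar unless \<open>tr A = 1\<close>.\<close>
  have "(a + d - 1) * a = (a * a + b * c) - a + (a * d - b * c)"
    "(a + d - 1) * d = (c * b + d * d) - d + (a * d - b * c)"
    "(a + d - 1) * b = (a * b + b * d) - b" "(a + d - 1) * c = (c * a + d * c) - c"
    by (simp_all add: algebra_simps)
  then have trace_det: "(a + d - 1) * a = a * d - b * c" "(a + d - 1) * d = a * d - b * c"
      "(a + d - 1) * b = 0" "(a + d - 1) * c = 0"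
    using eqs by simp_all
  show ?char
  proof (cases "a + d = 1")
    case True
    then show ?thesis
      using trace_det(1) by simp
  next
    case False
    then have scalar: "b = 0" "c = 0" "d = a"
      using trace_det by auto
    then have "a = 0 \<or> a = 1"
      using eqs(1) by simp
    then show ?thesis
      using scalar by (auto simp: zero_mat_2 one_mat_2)
  qed
next
  assume ?char
  then consider (trace_det) "a + d = 1" "a * d = b * c" | (trivial) "mat2 a b c d \<in> {0\<^sub>m 2 2, 1\<^sub>m 2}"
    by blast
  then show ?idem
  proof cases
    case trace_det
    have d: "d = 1 - a"
      using trace_det(1) by (simp add: eq_diff_eq add.commute)
    show ?thesis
      using trace_det(2) by (simp add: mat2_mult d algebra_simps)
  qed (auto simp: zero_mat_2 one_mat_2 mat2_mult)
qed

lemma mat2_nontrivial_idempotent_iff: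
  fixes a :: "'a :: idom"
  shows "mat2 a b c d \<in> nontrivial_idempotents (ring_mat TYPE('a) 2 u) \<longleftrightarrow>
    a + d = 1 \<and> a * d = b * c"
  by (auto simp: nontrivial_idempotents_def ring_mat_simps mat2_idempotent_iff zero_mat_2 one_mat_2)

lemma nontrivial_idempotent_mat_2E:
  assumes "A \<in> nontrivial_idempotents (ring_mat TYPE('a :: idom) 2 u)"
  obtains a b c d where "A = mat2 a b c d" "a + d = 1" "a * d = b * c"
proof -
  have "A \<in> carrier_mat 2 2"
    using assms by (simp add: nontrivial_idempotents_def ring_mat_simps)
  then obtain a b c d where A: "A = mat2 a b c d"
    by (rule carrier_mat_2E)
  then show thesis
    using that[OF A] assms by (simp add: mat2_nontrivial_idempotent_iff)
qed

lemma nontrivial_idempotents_mat_2_add_notin: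
  assumes A: "A \<in> nontrivial_idempotents (ring_mat TYPE('a :: idom) 2 u)"
    and B: "B \<in> nontrivial_idempotents (ring_mat TYPE('a) 2 u)"
  shows "A + B \<notin> nontrivial_idempotents (ring_mat TYPE('a) 2 u)"
proof -
  obtain a b c d where A: "A = mat2 a b c d" "a + d = 1"
    using A by (rule nontrivial_idempotent_mat_2E)
  obtain a' b' c' d' where B: "B = mat2 a' b' c' d'" "a' + d' = 1"
    using B by (rule nontrivial_idempotent_mat_2E)
  have "(a + a') + (d + d') = (a + d) + (a' + d')"
    by (simp add: ac_simps)
  also have "\<dots> \<noteq> 1"
    unfolding A(2) B(2) add_cancel_left_right by simp
  finally show ?thesis
    by (simp add: A(1) B(1) mat2_add mat2_nontrivial_idempotent_iff)
qed

lemma nontrivial_idempotents_mat_2: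
  "nontrivial_idempotents (ring_mat TYPE('a :: idom) 2 u) =
    (\<lambda>(a, b, c). mat2 a b c (1 - a)) ` {(a, b, c). b * c = a * (1 - a)}"
proof (intro equalityI subsetI)
  fix A :: "'a mat" assume "A \<in> nontrivial_idempotents (ring_mat TYPE('a) 2 u)"
  then obtain a b c d where A: "A = mat2 a b c d" and "a + d = 1" "a * d = b * c"
    by (rule nontrivial_idempotent_mat_2E)
  then have "d = 1 - a" "b * c = a * d"
    by (simp_all add: eq_diff_eq add.commute)
  then show "A \<in> (\<lambda>(a, b, c). mat2 a b c (1 - a)) ` {(a, b, c). b * c = a * (1 - a)}"
    by (auto simp: A intro: image_eqI[where x = "(a, b, c)"])
qed (auto simp: mat2_nontrivial_idempotent_iff)

lemma card_solutions_mult_eq: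
  fixes f :: "'b :: finite \<Rightarrow> 'a :: {field, finite}"
  shows "card {(x, b, c). b * c = f x} = CARD('b) * (CARD('a) - 1) + card {x. f x = 0} * CARD('a)"
proof -
  let ?g = "\<lambda>(x, b). (x, b, f x / b)"
  let ?nonzero = "?g ` (UNIV \<times> (UNIV - {0}))" and ?zero = "{x. f x = 0} \<times> {0 :: 'a} \<times> (UNIV :: 'a set)"
  have "{(x, b, c). b * c = f x} = ?nonzero \<union> ?zero"
  proof -
    have "b * c = f x \<longleftrightarrow> (if b = 0 then f x = 0 else c = f x / b)" for x b c
      by (auto simp: field_simps)
    then show ?thesis
      by (auto simp: image_iff split: if_splits)
  qed
  moreover have "card (?nonzero \<union> ?zero) = card ?nonzero + card ?zero"
    by (rule card_Un_disjoint) auto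
  moreover have "card ?nonzero = CARD('b) * (CARD('a) - 1)"
    by (subst card_image) (auto simp: inj_on_def card_cartesian_product card_Diff_subset)
  moreover have "card ?zero = card {x. f x = 0} * CARD('a)"
    by (simp add: card_cartesian_product)
  ultimately show ?thesis
    by simp
qed

lemma card_nontrivial_idempotents_mat_2:
  "card (nontrivial_idempotents (ring_mat TYPE('a :: {field, finite}) 2 u)) =
    CARD('a) * (CARD('a) + 1)"
proof -
  have "inj_on (\<lambda>(a :: 'a, b, c). mat2 a b c (1 - a)) {(a, b, c). b * c = a * (1 - a)}"
    by (auto simp: inj_on_def)
  then have "card (nontrivial_idempotents (ring_mat TYPE('a) 2 u)) =
      card {(a :: 'a, b, c). b * c = a * (1 - a)}"
    by (simp add: nontrivial_idempotents_mat_2 card_image)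
  also have "\<dots> = CARD('a) * (CARD('a) - 1) + card {a :: 'a. a * (1 - a) = 0} * CARD('a)"
    by (rule card_solutions_mult_eq)
  also have "{a :: 'a. a * (1 - a) = 0} = {0, 1}"
    by auto
  also have "CARD('a) * (CARD('a) - 1) + card {0, 1 :: 'a} * CARD('a) = CARD('a) * (CARD('a) + 1)"
    by (cases "CARD('a)") auto
  finally show ?thesis .
qed

theorem theorem3p7:
  fixes n :: nat
  assumes "n = CARD('a :: {field, finite})"
  shows "digraph_iso
           (with_proj (idempotent_graph (ring_mat TYPE('a) 2 ())))
           (with_proj (disjoint_copies (n * (n + 1) div 2) (complete_graph 2)))"
proof -
  let ?R = "ring_mat TYPE('a) 2 ()"
  interpret ring ?R
    by (rule ring_mat)
  have "finite (nontrivial_idempotents ?R)"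
    by (simp add: nontrivial_idempotents_mat_2)
  moreover have "A \<oplus>\<^bsub>?R\<^esub> B \<notin> nontrivial_idempotents ?R"
    if "(A, B) \<in> parcs (idempotent_graph ?R)" for A B
    using that nontrivial_idempotents_mat_2_add_notin[of A "()" B]
    by (simp add: idempotent_graph_def ring_mat_simps)
  moreover have "card (nontrivial_idempotents ?R) = n * (n + 1)"
    by (simp add: card_nontrivial_idempotents_mat_2 assms)
  ultimately show ?thesis
    using idempotent_graph_iso_disjoint_copies_K2 by metis
qed

end
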